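(* Let $T$ be a rooted tree of depth $s$ that is a unit bar visibility graph. Then $T$ has at most $s^2+2s$ edges.
   Context: The depth of a rooted tree is the maximum distance from the root to a vertex. A finite simple graph is a unit bar visibility graph (UBVG) if its vertices can be represented by pairwise disjoint closed horizontal line segments ("bars") of unit length in the plane in such a way that two distinct vertices are adjacent if and only if there is an unobstructed non-degenerate (positive width) vertical band of visibility joining the two corresponding bars, i.e. an open interval $I$ of positive length such that for every $x_0\in I$ the line $x=x_0$ meets both bars and the part of this line strictly between them meets no other bar. *)

theory Defs
  imports "HOL-Analysis.Analysis"
begin

definition simple_graph :: "'a set \<Rightarrow> 'a set set \<Rightarrow> bool" where
  "simple_graph V E \<longleftrightarrow> finite V \<and> (\<forall>e\<in>E. e \<subseteq> V \<and> card e = 2)"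

definition walk :: "'a set \<Rightarrow> 'a set set \<Rightarrow> 'a list \<Rightarrow> bool" where
  "walk V E p \<longleftrightarrow> p \<noteq> [] \<and> set p \<subseteq> V \<and> successively (\<lambda>u v. {u, v} \<in> E) p"

definition walk_betw :: "'a set \<Rightarrow> 'a set set \<Rightarrow> 'a \<Rightarrow> 'a list \<Rightarrow> 'a \<Rightarrow> bool" where
  "walk_betw V E u p v \<longleftrightarrow> walk V E p \<and> hd p = u \<and> last p = v"

definition connected_graph :: "'a set \<Rightarrow> 'a set set \<Rightarrow> bool" where
  "connected_graph V E \<longleftrightarrow> V \<noteq> {} \<and> (\<forall>u\<in>V. \<forall>v\<in>V. \<exists>p. walk_betw V E u p v)"

text \<open>A cycle is listed without repeating its first vertex at the end.\<close>

definition cycle :: "'a set \<Rightarrow> 'a set set \<Rightarrow> 'a list \<Rightarrow> bool" where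
  "cycle V E p \<longleftrightarrow> walk V E p \<and> distinct p \<and> length p \<ge> 3 \<and> {last p, hd p} \<in> E"

definition tree_graph :: "'a set \<Rightarrow> 'a set set \<Rightarrow> bool" where
  "tree_graph V E \<longleftrightarrow> simple_graph V E \<and> connected_graph V E \<and> (\<nexists>p. cycle V E p)"

definition rooted_tree :: "'a set \<Rightarrow> 'a set set \<Rightarrow> 'a \<Rightarrow> bool" where
  "rooted_tree V E r \<longleftrightarrow> tree_graph V E \<and> r \<in> V"

text \<open>A walk with \<open>n + 1\<close> vertices has length \<open>n\<close>.  The value is only meaningful when
  \<open>u\<close> and \<open>v\<close> are joined by a walk.\<close>

definition graph_dist :: "'a set \<Rightarrow> 'a set set \<Rightarrow> 'a \<Rightarrow> 'a \<Rightarrow> nat" where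
  "graph_dist V E u v = (LEAST n. \<exists>p. walk_betw V E u p v \<and> length p = Suc n)"

definition depth :: "'a set \<Rightarrow> 'a set set \<Rightarrow> 'a \<Rightarrow> nat" where
  "depth V E r = Max (graph_dist V E r ` V)"

definition unit_bar :: "(real \<times> real) set \<Rightarrow> bool" where
  "unit_bar b \<longleftrightarrow> (\<exists>a h. b = {a..a + 1} \<times> {h})"

text \<open>The points \<open>(x, y)\<close> and \<open>(x, y')\<close> are where the vertical line through \<open>x\<close> meets
  the bars of \<open>u\<close> and \<open>v\<close>; the part of the line strictly between these bars is the open
  segment joining the two points.\<close>

definition bars_visible ::
  "'a set \<Rightarrow> ('a \<Rightarrow> (real \<times> real) set) \<Rightarrow> 'a \<Rightarrow> 'a \<Rightarrow> bool" where
  "bars_visible V B u v \<longleftrightarrow>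
     (\<exists>c d. c < d \<and>
       (\<forall>x\<in>{c<..<d}. \<exists>y y'. (x, y) \<in> B u \<and> (x, y') \<in> B v \<and>
          (\<forall>w\<in>V - {u, v}. open_segment (x, y) (x, y') \<inter> B w = {})))"

definition unit_bar_visibility_graph :: "'a set \<Rightarrow> 'a set set \<Rightarrow> bool" where
  "unit_bar_visibility_graph V E \<longleftrightarrow>
     simple_graph V E \<and>
     (\<exists>B. (\<forall>v\<in>V. unit_bar (B v)) \<and> disjoint_family_on B V \<and>
        (\<forall>u\<in>V. \<forall>v\<in>V. u \<noteq> v \<longrightarrow> ({u, v} \<in> E \<longleftrightarrow> bars_visible V B u v)))"

end

theory Submission
  imports Defs
begin

text \<open>In a tree, two neighbours of \<open>u\<close> joined by a path avoiding \<open>u\<close> coincide. The bars met by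
  a vertical line \<open>x = x\<^sub>0\<close> form a path of the graph as soon as \<open>x\<^sub>0\<close> is not the abscissa of an end
  of a bar, and lines just beyond an end of the bar of \<open>u\<close> give paths avoiding \<open>u\<close>. Hence \<open>u\<close> has at
  most one neighbour shifted to the left, at most one shifted to the right, degree at most 3, and
  both shifted neighbours if its degree is 3. In that case \<open>u\<close> lies on every connected set \<open>Q\<close> of
  bars that contains a leftmost and a rightmost one: otherwise bars of \<open>Q\<close> crossing the vertical
  lines at the two ends of \<open>u\<close> would connect both shifted neighbours of \<open>u\<close> around \<open>u\<close>. Taking for
  \<open>Q\<close> two geodesics to the root, each level contains at most two vertices of degree 3. So the first
  level has at most 3 vertices, each further level at most two more than the one before it, and
  the tree has at most \<open>1 + 3 + 5 + \<dots> + (2 * s + 1) = (s + 1)\<^sup>2\<close> vertices.\<close>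

section \<open>Paths and levels in trees\<close>

text \<open>The closure \<open>(adj_on E S)\<^sup>*\<close> expresses joinability by a path inside
  \<open>S\<close>. It is reflexive also outside \<open>S\<close>, so a trivial path carries no
  information about membership in \<open>S\<close>.\<close>

definition adj_on :: "'a set set \<Rightarrow> 'a set \<Rightarrow> ('a \<times> 'a) set" where
  "adj_on E S = {(v, w). v \<in> S \<and> w \<in> S \<and> {v, w} \<in> E}"

lemma adj_on_mono: "S \<subseteq> S' \<Longrightarrow> (adj_on E S)\<^sup>* \<subseteq> (adj_on E S')\<^sup>*"
  by (rule rtrancl_mono) (auto simp: adj_on_def)

lemma adj_on_rtrancl_sym: "(v, w) \<in> (adj_on E S)\<^sup>* \<Longrightarrow> (w, v) \<in> (adj_on E S)\<^sup>*"
proof -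
  have "sym (adj_on E S)" by (auto simp: sym_def adj_on_def insert_commute)
  then show "(v, w) \<in> (adj_on E S)\<^sup>* \<Longrightarrow> (w, v) \<in> (adj_on E S)\<^sup>*"
    by (metis sym_rtrancl symD)
qed

lemma adj_on_rtrancl_distinct_walk:
  assumes "(v, w) \<in> (adj_on E S)\<^sup>*" and "w \<in> S"
  shows "\<exists>p. p \<noteq> [] \<and> set p \<subseteq> S \<and> successively (\<lambda>u v. {u, v} \<in> E) p \<and> hd p = v \<and> last p = w
    \<and> distinct p"
  using assms
proof (induction rule: converse_rtrancl_induct)
  case base
  then show ?case by (intro exI[of _ "[w]"]) auto
next
  case (step x y)
  then obtain p where p: "p \<noteq> []" "set p \<subseteq> S" "successively (\<lambda>u v. {u, v} \<in> E) p"
    "hd p = y" "last p = w" "distinct p" by auto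
  show ?case
  proof (cases "x \<in> set p")
    case True
    then obtain ps qs where "p = ps @ x # qs" by (meson split_list)
    \<comment> \<open>If \<open>x\<close> already lies on the path, the part before its occurrence
      is a detour and is cut off, which keeps the path simple.\<close>
    with p show ?thesis
      by (intro exI[of _ "x # qs"]) (auto simp: successively_append_iff)
  next
    case False
    with p step.hyps(1) show ?thesis
      by (intro exI[of _ "x # p"]) (auto simp: adj_on_def successively_Cons)
  qed
qed

text \<open>A simple path from \<open>v\<close> to \<open>w\<close> avoiding \<open>u\<close> would
  close up through \<open>u\<close> to a cycle; \<open>v \<noteq> w\<close> makes this cycle have at
  least three vertices.\<close>

lemma tree_graph_neighbours_separated:
  assumes "tree_graph V E" and u: "u \<in> V" and uv: "{u, v} \<in> E" and uw: "{u, w} \<in> E"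
    and vw: "(v, w) \<in> (adj_on E (V - {u}))\<^sup>*"
  shows "v = w"
proof (rule ccontr)
  assume "v \<noteq> w"
  have "w \<in> V - {u}"
    using assms(1) uw by (auto simp: tree_graph_def simple_graph_def dest!: bspec[of E])
  from adj_on_rtrancl_distinct_walk[OF vw this] obtain p where p: "p \<noteq> []" "set p \<subseteq> V - {u}"
    "successively (\<lambda>u v. {u, v} \<in> E) p" "hd p = v" "last p = w" "distinct p" by auto
  have "length p \<ge> 2"
  proof (rule ccontr)
    assume "\<not> length p \<ge> 2"
    with p(1) obtain x where "p = [x]" by (cases p) (auto simp: Suc_le_eq)
    with p \<open>v \<noteq> w\<close> show False by auto
  qed
  then have "cycle V E (u # p)"
    using p u uv uw by (auto simp: cycle_def walk_def successively_Cons insert_commute)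
  with assms(1) show False by (auto simp: tree_graph_def)
qed

lemma graph_dist_le:
  "walk_betw V E u p v \<Longrightarrow> length p = Suc n \<Longrightarrow> graph_dist V E u v \<le> n"
  unfolding graph_dist_def by (rule Least_le) blast

lemma graph_dist_walk:
  assumes "connected_graph V E" "u \<in> V" "v \<in> V"
  obtains p where "walk_betw V E u p v" "length p = Suc (graph_dist V E u v)"
proof -
  from assms obtain p where p: "walk_betw V E u p v" by (auto simp: connected_graph_def)
  then have "length p = Suc (length p - 1)" by (cases p) (auto simp: walk_betw_def walk_def)
  with p have "\<exists>n p. walk_betw V E u p v \<and> length p = Suc n" by blast
  from LeastI_ex[OF this] that show thesis unfolding graph_dist_def by blast
qed

lemma graph_dist_self: "r \<in> V \<Longrightarrow> graph_dist V E r r = 0"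
  using graph_dist_le[of V E r "[r]" r 0] by (auto simp: walk_betw_def walk_def)

lemma graph_dist_edge:
  assumes "connected_graph V E" "r \<in> V" "u \<in> V" "v \<in> V" "{u, v} \<in> E"
  shows "graph_dist V E r v \<le> Suc (graph_dist V E r u)"
proof -
  obtain p where "walk_betw V E r p u" "length p = Suc (graph_dist V E r u)"
    using graph_dist_walk assms by metis
  then show ?thesis
    using assms by (intro graph_dist_le[of _ _ _ "p @ [v]"])
      (auto simp: walk_betw_def walk_def successively_append_iff)
qed

lemma graph_dist_parent:
  assumes "connected_graph V E" "r \<in> V" "v \<in> V" "v \<noteq> r"
  shows "\<exists>u\<in>V. {u, v} \<in> E \<and> graph_dist V E r v = Suc (graph_dist V E r u)"
proof -
  obtain p where p: "walk_betw V E r p v" "length p = Suc (graph_dist V E r v)"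
    using graph_dist_walk assms by metis
  define q where "q = butlast p"
  have pq: "p = q @ [v]"
    using p(1) unfolding q_def by (metis append_butlast_last_id walk_betw_def walk_def)
  with p(1) \<open>v \<noteq> r\<close> have "q \<noteq> []" by (auto simp: walk_betw_def)
  with p(1) pq have q: "walk_betw V E r q (last q)" and e: "{last q, v} \<in> E" and l: "last q \<in> V"
    by (auto simp: walk_betw_def walk_def successively_append_iff)
  have "length q = Suc (length q - 1)" using \<open>q \<noteq> []\<close> by (cases q) auto
  from graph_dist_le[OF q this] have "graph_dist V E r (last q) \<le> length q - 1" .
  with p(2) pq \<open>q \<noteq> []\<close> have "Suc (graph_dist V E r (last q)) \<le> graph_dist V E r v"
    by (cases q) auto
  with graph_dist_edge[OF assms(1,2) l assms(3) e] e l show ?thesis by force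
qed

text \<open>\<open>S\<close> is the vertex set of a geodesic from \<open>v\<close> to the root.
  Injectivity of the distance records that it meets each level at most once.\<close>

lemma geodesic_set:
  assumes "connected_graph V E" "r \<in> V" "v \<in> V"
  shows "\<exists>S\<subseteq>V. v \<in> S \<and> (\<forall>w\<in>S. (w, r) \<in> (adj_on E S)\<^sup>*) \<and> inj_on (graph_dist V E r) S
    \<and> (\<forall>w\<in>S. graph_dist V E r w \<le> graph_dist V E r v)"
  using assms(3)
proof (induction "graph_dist V E r v" arbitrary: v rule: less_induct)
  case less
  show ?case
  proof (cases "v = r")
    case True
    then show ?thesis using less.prems by (intro exI[of _ "{v}"]) auto
  next
    case False
    then obtain u where u: "u \<in> V" "{u, v} \<in> E" "graph_dist V E r v = Suc (graph_dist V E r u)"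
      using graph_dist_parent assms less.prems by metis
    with less.hyps[of u] obtain S where S: "S \<subseteq> V" "u \<in> S" "\<forall>w\<in>S. (w, r) \<in> (adj_on E S)\<^sup>*"
      "inj_on (graph_dist V E r) S" "\<forall>w\<in>S. graph_dist V E r w \<le> graph_dist V E r u" by auto
    have "(v, u) \<in> adj_on E (insert v S)" using S u by (auto simp: adj_on_def insert_commute)
    moreover have old: "(w, r) \<in> (adj_on E (insert v S))\<^sup>*" if "w \<in> S" for w
      using S(3) that adj_on_mono[of S "insert v S"] by blast
    ultimately have "(v, r) \<in> (adj_on E (insert v S))\<^sup>*"
      using S(2) by (meson converse_rtrancl_into_rtrancl)
    with old have "\<forall>w\<in>insert v S. (w, r) \<in> (adj_on E (insert v S))\<^sup>*" by blast
    moreover have "inj_on (graph_dist V E r) (insert v S)"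
      using S(4,5) u(3) by (fastforce simp: inj_on_def)
    moreover have "\<forall>w\<in>insert v S. graph_dist V E r w \<le> graph_dist V E r v"
      using S(5) u(3) by fastforce
    ultimately show ?thesis using S(1) less.prems by (intro exI[of _ "insert v S"]) simp
  qed
qed

text \<open>Every edge joins a non-root vertex to its parent, so the non-root vertices map onto a
  set containing \<open>E\<close>.\<close>

lemma card_edges_less_card_vertices:
  assumes "rooted_tree V E r"
  shows "Suc (card E) \<le> card V"
proof -
  let ?d = "graph_dist V E r"
  have tree: "tree_graph V E" and r: "r \<in> V" using assms by (auto simp: rooted_tree_def)
  then have con: "connected_graph V E" and fin: "finite V"
    and edge: "\<And>e. e \<in> E \<Longrightarrow> e \<subseteq> V \<and> card e = 2"
    by (auto simp: tree_graph_def simple_graph_def)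
  have "\<forall>v\<in>V - {r}. \<exists>u. u \<in> V \<and> {u, v} \<in> E \<and> ?d v = Suc (?d u)"
    using graph_dist_parent[OF con r] by blast
  then obtain par where par: "\<And>v. v \<in> V \<Longrightarrow> v \<noteq> r \<Longrightarrow>
      par v \<in> V \<and> {par v, v} \<in> E \<and> ?d v = Suc (?d (par v))"
    by (metis DiffI singletonD)
  \<comment> \<open>Both \<open>u\<close> and \<open>par v\<close> are neighbours of
    \<open>v\<close>, and their geodesics to the root avoid \<open>v\<close>; joined at the root,
    these force \<open>u = par v\<close>. In particular no edge lies within a level.\<close>
  have parent_edge: "v \<noteq> r \<and> u = par v"
    if uv: "u \<in> V" "v \<in> V" "u \<noteq> v" "{u, v} \<in> E" "?d u \<le> ?d v" for u v
  proof -
    have "v \<noteq> r"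
    proof
      assume "v = r"
      with uv graph_dist_self[OF r, of E] have "?d u = 0" "u \<noteq> r" by auto
      with par[OF uv(1)] show False by auto
    qed
    note pv = par[OF uv(2) this]
    obtain S where S: "S \<subseteq> V" "\<forall>w\<in>S. (w, r) \<in> (adj_on E S)\<^sup>*" "inj_on ?d S" "u \<in> S" "\<forall>w\<in>S. ?d w \<le> ?d u"
      using geodesic_set[OF con r uv(1)] by auto
    obtain S' where S': "S' \<subseteq> V" "par v \<in> S'" "\<forall>w\<in>S'. (w, r) \<in> (adj_on E S')\<^sup>*" "\<forall>w\<in>S'. ?d w \<le> ?d (par v)"
      using geodesic_set[OF con r, of "par v"] pv by auto
    \<comment> \<open>No vertex of \<open>S\<close> is farther from the root than \<open>u\<close>,
      and only \<open>u\<close> itself attains that distance.\<close>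
    have "v \<notin> S" using S uv by (metis inj_onD le_antisym)
    with S have "(u, r) \<in> (adj_on E (V - {v}))\<^sup>*" using adj_on_mono[of S "V - {v}"] by blast
    moreover have "v \<notin> S'" using S' pv by force
    with S' have "S' \<subseteq> V - {v}" by blast
    with S' have "(par v, r) \<in> (adj_on E (V - {v}))\<^sup>*" by (meson adj_on_mono subsetD)
    then have "(r, par v) \<in> (adj_on E (V - {v}))\<^sup>*" by (rule adj_on_rtrancl_sym)
    ultimately have "(u, par v) \<in> (adj_on E (V - {v}))\<^sup>*" by (rule rtrancl_trans)
    with tree_graph_neighbours_separated[OF tree uv(2)] uv(4) pv have "u = par v"
      by (metis insert_commute)
    with \<open>v \<noteq> r\<close> show ?thesis by simp
  qed
  have "E \<subseteq> (\<lambda>v. {par v, v}) ` (V - {r})"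
  proof
    fix e assume e: "e \<in> E"
    with edge obtain u v where uv: "e = {u, v}" "u \<noteq> v" by (meson card_2_iff)
    with edge[OF e] have V: "u \<in> V" "v \<in> V" by auto
    consider "?d u \<le> ?d v" | "?d v \<le> ?d u" by linarith
    then show "e \<in> (\<lambda>v. {par v, v}) ` (V - {r})"
    proof cases
      case 1
      with parent_edge[of u v] uv V e show ?thesis by auto
    next
      case 2
      with parent_edge[of v u] uv V e show ?thesis by (auto simp: insert_commute)
    qed
  qed
  then have "card E \<le> card (V - {r})" using fin by (meson finite_Diff surj_card_le)
  moreover have "card V = Suc (card (V - {r}))" using fin r by (rule card.remove)
  ultimately show ?thesis by simp
qed

section \<open>Unit bars representing a tree\<close>

lemma generic_point:
  fixes c d :: real
  assumes "finite F" "c < d"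
  obtains x where "c < x" "x < d" "x \<notin> F"
proof -
  have "infinite ({c<..<d} - F)" using assms by (simp add: infinite_Ioo)
  then obtain x where "x \<in> {c<..<d} - F" by (metis ex_in_conv finite.emptyI)
  with that show thesis by auto
qed

lemma generic_neighbourhood:
  fixes x :: real
  assumes "finite F" "x \<notin> F"
  obtains c d where "c < x" "x < d" "{c<..<d} \<inter> F = {}"
proof -
  obtain e where "e > 0" "ball x e \<subseteq> - F"
    using assms finite_imp_closed[of F] by (metis Compl_iff open_Compl open_contains_ball)
  with that[of "x - e" "x + e"] show thesis by (auto simp: ball_eq_greaterThanLessThan)
qed

lemma vertical_open_segmentD:
  fixes x y y' :: real
  assumes "(x', z) \<in> open_segment (x, y) (x, y')"
  shows "x' = x" "min y y' < z" "z < max y y'"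
proof -
  obtain t where t: "0 < t" "t < 1" "x' = (1 - t) * x + t * x" "z = (1 - t) * y + t * y'"
    and ne: "y \<noteq> y'"
    using assms by (auto simp: in_segment)
  from t show "x' = x" by (simp add: algebra_simps)
  have z: "z - y = t * (y' - y)" "y' - z = (1 - t) * (y' - y)" unfolding t(4) by (simp_all add: algebra_simps)
  have "min y y' < z \<and> z < max y y'"
  proof (cases "y < y'")
    case True
    then have "0 < z - y" "0 < y' - z" unfolding z using t by simp_all
    then show ?thesis by simp
  next
    case False
    then have "z - y < 0" "y' - z < 0" unfolding z using t ne by (simp_all add: mult_pos_neg)
    then show ?thesis by simp
  qed
  then show "min y y' < z" "z < max y y'" by auto
qed

locale unit_bar_tree =
  fixes V :: "'a set" and E :: "'a set set" and a h :: "'a \<Rightarrow> real"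
  assumes tree: "tree_graph V E"
    and disjoint: "disjoint_family_on (\<lambda>v. {a v..a v + 1} \<times> {h v}) V"
    and edge_iff: "\<And>u v. u \<in> V \<Longrightarrow> v \<in> V \<Longrightarrow> u \<noteq> v \<Longrightarrow>
      {u, v} \<in> E \<longleftrightarrow> bars_visible V (\<lambda>v. {a v..a v + 1} \<times> {h v}) u v"
begin

lemma finite_V: "finite V"
  using tree by (simp add: tree_graph_def simple_graph_def)

lemma edgeD: "{u, v} \<in> E \<Longrightarrow> u \<in> V \<and> v \<in> V \<and> u \<noteq> v"
  using tree by (fastforce simp: tree_graph_def simple_graph_def)

lemma heights_differ:
  assumes "u \<in> V" "v \<in> V" "u \<noteq> v" "a u \<le> x" "x \<le> a u + 1" "a v \<le> x" "x \<le> a v + 1"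
  shows "h u \<noteq> h v"
proof
  assume "h u = h v"
  then have "(x, h u) \<in> ({a u..a u + 1} \<times> {h u}) \<inter> ({a v..a v + 1} \<times> {h v})" using assms by auto
  with disjoint assms(1-3) show False by (fastforce simp: disjoint_family_on_def)
qed

text \<open>A band of positive width provides two distinct common abscissas; a single one would only
  give the non-strict inequality.\<close>

lemma edge_overlap:
  assumes "{u, v} \<in> E"
  shows "\<bar>a u - a v\<bar> < 1" "h u \<noteq> h v"
proof -
  note uv = edgeD[OF assms]
  with assms edge_iff obtain c d where cd: "c < d"
    and c: "\<And>x. x \<in> {c<..<d} \<Longrightarrow> \<exists>y y'. (x, y) \<in> {a u..a u + 1} \<times> {h u} \<and>
      (x, y') \<in> {a v..a v + 1} \<times> {h v}"
    unfolding bars_visible_def by meson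
  define x where "x = c + (d - c) / 3"
  define x' where "x' = c + (d - c) / 3 * 2"
  have "x \<in> {c<..<d}" "x' \<in> {c<..<d}" "x < x'" using cd unfolding x_def x'_def by (auto simp: field_simps)
  with c[of x] c[of x'] have "a u \<le> x" "a v \<le> x" "x' \<le> a u + 1" "x' \<le> a v + 1" by auto
  with \<open>x < x'\<close> uv heights_differ[of u v x] show "\<bar>a u - a v\<bar> < 1" "h u \<noteq> h v" by auto
qed

section \<open>Stacks of bars on vertical lines\<close>

definition ends :: "real set" where
  "ends = a ` V \<union> (\<lambda>v. a v + 1) ` V"

text \<open>For \<open>x\<close> outside \<open>ends\<close>, the open condition agrees with the
  line at \<open>x\<close> meeting the closed bar.\<close>

definition over :: "real \<Rightarrow> 'a set" where
  "over x = {v \<in> V. a v < x \<and> x < a v + 1}"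

lemma finite_ends: "finite ends"
  by (simp add: ends_def finite_V)

lemma edge_if_consecutive:
  assumes x: "x \<notin> ends" and u: "u \<in> over x" and v: "v \<in> over x" and "h u < h v"
    and none: "\<And>w. w \<in> over x \<Longrightarrow> \<not> (h u < h w \<and> h w < h v)"
  shows "{u, v} \<in> E"
proof -
  obtain c d where cd: "c < x" "x < d" "{c<..<d} \<inter> ends = {}"
    using generic_neighbourhood[OF finite_ends x] by blast
  \<comment> \<open>No bar begins or ends within the interval, so all its vertical lines meet the
    same bars as the line at \<open>x\<close>; this yields a whole band of visibility.\<close>
  have near: "(a w \<le> x' \<and> x' \<le> a w + 1) \<longleftrightarrow> w \<in> over x" if "w \<in> V" "x' \<in> {c<..<d}" for w x'
  proof -
    have "a w \<notin> {c<..<d}" "a w + 1 \<notin> {c<..<d}" using cd that by (auto simp: ends_def)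
    with cd that show ?thesis by (auto simp: over_def)
  qed
  have uv: "u \<in> V" "v \<in> V" "u \<noteq> v" using u v \<open>h u < h v\<close> by (auto simp: over_def)
  have "open_segment (x', h u) (x', h v) \<inter> {a w..a w + 1} \<times> {h w} = {}"
    if "x' \<in> {c<..<d}" "w \<in> V" for x' w
  proof (rule ccontr)
    assume "open_segment (x', h u) (x', h v) \<inter> {a w..a w + 1} \<times> {h w} \<noteq> {}"
    then obtain z where z: "(z, h w) \<in> open_segment (x', h u) (x', h v)" "a w \<le> z" "z \<le> a w + 1" by auto
    with vertical_open_segmentD[OF z(1)] \<open>h u < h v\<close> near[OF that(2,1)] none[of w] show False by auto
  qed
  then have "bars_visible V (\<lambda>v. {a v..a v + 1} \<times> {h v}) u v"
    unfolding bars_visible_def using cd near[OF uv(1)] near[OF uv(2)] u v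
    by (intro exI[of _ c] exI[of _ d]) auto
  with edge_iff uv show ?thesis by blast
qed

text \<open>Induction on the number of bars strictly between: with none the two bars are adjacent,
  otherwise the stack is split at an intermediate bar.\<close>

lemma stack_connected_aux:
  assumes x: "x \<notin> ends"
  shows "u \<in> over x \<Longrightarrow> v \<in> over x \<Longrightarrow> h u < h v \<Longrightarrow>
    (u, v) \<in> (adj_on E {w \<in> over x. h u \<le> h w \<and> h w \<le> h v})\<^sup>*"
proof (induction "card {w \<in> over x. h u < h w \<and> h w < h v}" arbitrary: u v rule: less_induct)
  case less
  let ?B = "\<lambda>u v. {w \<in> over x. h u < h w \<and> h w < h v}"
  have fin: "finite (?B u v)" for u v using finite_V by (simp add: over_def)
  show ?case
  proof (cases "?B u v = {}")
    case True
    then have "{u, v} \<in> E" using edge_if_consecutive[OF x less.prems] by blast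
    with less.prems show ?thesis by (auto simp: adj_on_def)
  next
    case False
    then obtain w where w: "w \<in> over x" "h u < h w" "h w < h v" by auto
    have "?B u w \<subset> ?B u v" "?B w v \<subset> ?B u v" using w by auto
    then have "card (?B u w) < card (?B u v)" "card (?B w v) < card (?B u v)"
      using psubset_card_mono[OF fin] by blast+
    with less.hyps[of u w] less.hyps[of w v] less.prems w
    have "(u, w) \<in> (adj_on E {z \<in> over x. h u \<le> h z \<and> h z \<le> h w})\<^sup>*"
      "(w, v) \<in> (adj_on E {z \<in> over x. h w \<le> h z \<and> h z \<le> h v})\<^sup>*" by auto
    moreover have "{z \<in> over x. h u \<le> h z \<and> h z \<le> h w} \<subseteq> {z \<in> over x. h u \<le> h z \<and> h z \<le> h v}"
      "{z \<in> over x. h w \<le> h z \<and> h z \<le> h v} \<subseteq> {z \<in> over x. h u \<le> h z \<and> h z \<le> h v}"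
      using w by auto
    ultimately show ?thesis by (meson adj_on_mono rtrancl_trans subsetD)
  qed
qed

lemma stack_connected:
  assumes "x \<notin> ends" "u \<in> over x" "v \<in> over x"
    and "\<And>w. w \<in> over x \<Longrightarrow> min (h u) (h v) \<le> h w \<Longrightarrow> h w \<le> max (h u) (h v) \<Longrightarrow> w \<in> S"
  shows "(u, v) \<in> (adj_on E S)\<^sup>*"
proof (cases "u = v")
  case False
  with heights_differ[of u v x] assms(2,3) have "h u \<noteq> h v" by (auto simp: over_def)
  then consider "h u < h v" | "h v < h u" by linarith
  then show ?thesis
  proof cases
    case 1
    with assms have "{w \<in> over x. h u \<le> h w \<and> h w \<le> h v} \<subseteq> S" by auto
    with stack_connected_aux[OF assms(1-3) 1] show ?thesis by (meson adj_on_mono subsetD)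
  next
    case 2
    with assms have "{w \<in> over x. h v \<le> h w \<and> h w \<le> h u} \<subseteq> S" by auto
    with stack_connected_aux[OF assms(1,3,2) 2] show ?thesis
      by (meson adj_on_mono adj_on_rtrancl_sym subsetD)
  qed
qed simp

text \<open>Both bars span the strip from \<open>c\<close> to \<open>d\<close>, which lies beside
  \<open>u\<close>. The entire stack on a generic line of this strip therefore avoids
  \<open>u\<close>.\<close>

lemma connected_avoiding_outside:
  assumes "u \<in> V" "v \<in> V" "w \<in> V" "c < d" "d \<le> a u \<or> a u + 1 \<le> c"
    and "a v \<le> c" "d \<le> a v + 1" "a w \<le> c" "d \<le> a w + 1"
  shows "(v, w) \<in> (adj_on E (V - {u}))\<^sup>*"
proof -
  obtain x where "c < x" "x < d" "x \<notin> ends" using generic_point[OF finite_ends assms(4)] by blast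
  with assms show ?thesis by (intro stack_connected[of x]) (auto simp: over_def)
qed

section \<open>Neighbours and degrees\<close>

definition nbrs :: "'a \<Rightarrow> 'a set" where
  "nbrs u = {v. {u, v} \<in> E}"

lemma nbrsD:
  assumes "v \<in> nbrs u"
  shows "u \<in> V" "v \<in> V" "u \<noteq> v" "\<bar>a u - a v\<bar> < 1" "h u \<noteq> h v"
  using assms edgeD edge_overlap by (auto simp: nbrs_def)

lemma nbrs_separated:
  assumes "v \<in> nbrs u" "w \<in> nbrs u" "(v, w) \<in> (adj_on E (V - {u}))\<^sup>*"
  shows "v = w"
  using tree_graph_neighbours_separated[OF tree] assms nbrsD(1)[OF assms(1)] by (auto simp: nbrs_def)

text \<open>Both bars reach past \<open>a u\<close>, so they share a strip just left of
  \<open>u\<close>.\<close>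

lemma left_nbr_unique:
  assumes "v \<in> nbrs u" "w \<in> nbrs u" "a v < a u" "a w < a u"
  shows "v = w"
  using assms nbrsD[OF assms(1)] nbrsD[OF assms(2)]
  by (intro nbrs_separated[of v u w] connected_avoiding_outside[of u v w "max (a v) (a w)" "a u"]) auto

lemma right_nbr_unique:
  assumes "v \<in> nbrs u" "w \<in> nbrs u" "a u < a v" "a u < a w"
  shows "v = w"
  using assms nbrsD[OF assms(1)] nbrsD[OF assms(2)]
  by (intro nbrs_separated[of v u w] connected_avoiding_outside[of u v w "a u + 1" "min (a v) (a w) + 1"]) auto

text \<open>If the two neighbours, both above or both below \<open>u\<close>, overlapped in positive
  width, the stack between them would join them without using \<open>u\<close>. So their left ends
  are at least 1 apart, and as each is less than 1 away from \<open>a u\<close>, they lie strictly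
  on opposite sides of it.\<close>

lemma same_side_nbrs:
  assumes v: "v \<in> nbrs u" and w: "w \<in> nbrs u" and "v \<noteq> w" and side: "h u < h v \<longleftrightarrow> h u < h w"
  shows "a v < a u \<and> a u < a w \<or> a w < a u \<and> a u < a v"
proof -
  note nv = nbrsD[OF v] and nw = nbrsD[OF w]
  have "a v + 1 \<le> a w \<or> a w + 1 \<le> a v"
  proof (rule ccontr)
    assume "\<not> ?thesis"
    then have "max (a v) (a w) < min (a v) (a w) + 1" by auto
    then obtain x where x: "max (a v) (a w) < x" "x < min (a v) (a w) + 1" "x \<notin> ends"
      using generic_point[OF finite_ends] by blast
    have "(v, w) \<in> (adj_on E (V - {u}))\<^sup>*"
      using x nv nw side by (intro stack_connected[of x]) (auto simp: over_def)
    with nbrs_separated v w \<open>v \<noteq> w\<close> show False by blast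
  qed
  with nv nw show ?thesis by auto
qed

lemma finite_nbrs: "finite (nbrs u)"
  by (rule finite_subset[OF _ finite_V]) (auto simp: nbrs_def dest: edgeD)

text \<open>Vertices of degree 3 are branching, but a branching vertex can also have degree 2.\<close>

definition branching :: "'a \<Rightarrow> bool" where
  "branching u \<longleftrightarrow> (\<exists>v\<in>nbrs u. a v < a u) \<and> (\<exists>w\<in>nbrs u. a u < a w)"

lemma card_le_1I: "finite S \<Longrightarrow> (\<And>v w. v \<in> S \<Longrightarrow> w \<in> S \<Longrightarrow> v = w) \<Longrightarrow> card S \<le> 1"
  by (simp add: card_le_Suc0_iff_eq)

text \<open>Two neighbours above \<open>u\<close>, or two below, would be shifted in opposite
  directions and make \<open>u\<close> branching.\<close>

lemma card_nbrs_le_2: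
  assumes "\<not> branching u"
  shows "card (nbrs u) \<le> 2"
proof -
  let ?U = "{v \<in> nbrs u. h u < h v}" and ?D = "{v \<in> nbrs u. \<not> h u < h v}"
  have "card ?U \<le> 1" "card ?D \<le> 1"
    using same_side_nbrs assms unfolding branching_def
    by (intro card_le_1I; use finite_nbrs in \<open>simp; blast\<close>)+
  moreover have "nbrs u = ?U \<union> ?D" by auto
  then have "card (nbrs u) \<le> card ?U + card ?D" by (metis card_Un_le)
  ultimately show ?thesis by linarith
qed

lemma card_nbrs_le_3: "card (nbrs u) \<le> 3"
proof (cases "branching u")
  case True
  then obtain l where l: "l \<in> nbrs u" "a l < a u" unfolding branching_def by blast
  let ?L = "{v \<in> nbrs u. a v < a u}" and ?R = "{v \<in> nbrs u. a u < a v}"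
    and ?A = "{v \<in> nbrs u. a v = a u}"
  have fin: "finite ?L" "finite ?R" "finite ?A" using finite_nbrs by simp_all
  have "card ?L \<le> 1" by (rule card_le_1I[OF fin(1)]) (use left_nbr_unique in blast)
  moreover have "card ?R \<le> 1" by (rule card_le_1I[OF fin(2)]) (use right_nbr_unique in blast)
  moreover have "card ?A \<le> 1"
  proof (rule card_le_1I[OF fin(3)])
    fix v w assume vw: "v \<in> ?A" "w \<in> ?A"
    \<comment> \<open>An aligned neighbour cannot lie on the vertical side of the shifted neighbour
      \<open>l\<close>. Hence all aligned neighbours share the other side, where two of them cannot
      coexist.\<close>
    have "(h u < h z) \<noteq> (h u < h l)" if "z \<in> ?A" for z
      using same_side_nbrs[of z u l] that l by fastforce
    with vw have "(h u < h v) = (h u < h w)" by blast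
    with same_side_nbrs[of v u w] vw show "v = w" by auto
  qed
  moreover have "nbrs u = ?L \<union> ?R \<union> ?A" by auto
  then have "card (nbrs u) \<le> card ?L + card ?R + card ?A"
    by (metis (no_types, lifting) card_Un_le add_le_mono1 le_trans)
  ultimately show ?thesis by linarith
next
  case False
  then show ?thesis using card_nbrs_le_2[of u] by linarith
qed

text \<open>A discrete intermediate value argument: consecutive bars of a path overlap, so their
  projections leave no gap at \<open>t\<close>.\<close>

lemma crossing_bar:
  assumes "(p, q) \<in> (adj_on E Q)\<^sup>*" "q \<in> Q" "a p < t" "t < a q + 1"
  shows "\<exists>b\<in>Q. a b < t \<and> t < a b + 1"
  using assms
proof (induction rule: converse_rtrancl_induct)
  case base
  then show ?case by auto
next
  case (step y z)
  then have "{y, z} \<in> E" "y \<in> Q" by (auto simp: adj_on_def)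
  \<comment> \<open>If \<open>z\<close> starts at or beyond \<open>t\<close>, the overlap makes
    \<open>y\<close> itself extend past \<open>t\<close>; otherwise induction applies to
    \<open>z\<close>.\<close>
  with edge_overlap(1)[of y z] step show ?case by (cases "a z < t") force+
qed

text \<open>If \<open>u\<close> were missing from \<open>Q\<close>, its two shifted neighbours would
  be joined around it: from \<open>v\<close> to \<open>b\<close> left of \<open>u\<close>, from
  \<open>b\<close> to \<open>c\<close> within \<open>Q\<close>, and from \<open>c\<close> to
  \<open>w\<close> right of \<open>u\<close>.\<close>

lemma branching_on_spine:
  assumes "branching u" and Q: "Q \<subseteq> V" "p \<in> Q" "q \<in> Q" "\<And>v w. v \<in> Q \<Longrightarrow> w \<in> Q \<Longrightarrow> (v, w) \<in> (adj_on E Q)\<^sup>*"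
    and ext: "\<And>v. v \<in> V \<Longrightarrow> a p \<le> a v" "\<And>v. v \<in> V \<Longrightarrow> a v \<le> a q"
  shows "u \<in> Q"
proof (rule ccontr)
  assume "u \<notin> Q"
  from assms(1) obtain v w where v: "v \<in> nbrs u" "a v < a u" and w: "w \<in> nbrs u" "a u < a w"
    unfolding branching_def by blast
  note nv = nbrsD[OF v(1)] and nw = nbrsD[OF w(1)]
  have pq: "(p, q) \<in> (adj_on E Q)\<^sup>*" using Q by blast
  have "a p < a u" "a u < a q" using ext(1)[OF nv(2)] ext(2)[OF nw(2)] v w by auto
  then obtain b c where b: "b \<in> Q" "a b < a u" "a u < a b + 1"
    and c: "c \<in> Q" "a c < a u + 1" "a u + 1 < a c + 1"
    using crossing_bar[OF pq Q(3), of "a u"] crossing_bar[OF pq Q(3), of "a u + 1"] by auto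
  have "(v, b) \<in> (adj_on E (V - {u}))\<^sup>*"
    using v nv b Q by (intro connected_avoiding_outside[of _ _ _ "max (a v) (a b)" "a u"]) auto
  also have "(b, c) \<in> (adj_on E (V - {u}))\<^sup>*"
    using Q b c \<open>u \<notin> Q\<close> adj_on_mono[of Q "V - {u}" E] by blast
  also have "(c, w) \<in> (adj_on E (V - {u}))\<^sup>*"
    using w nw c Q by (intro connected_avoiding_outside[of _ _ _ "a u + 1" "min (a c) (a w) + 1"]) auto
  finally have "v = w" using nbrs_separated v w by blast
  with v w show False by simp
qed

section \<open>Counting by levels\<close>

lemma card_branching_level:
  assumes "r \<in> V"
  shows "card {v \<in> V. branching v \<and> graph_dist V E r v = i} \<le> 2"
proof -
  let ?d = "graph_dist V E r"
  have con: "connected_graph V E" using tree by (simp add: tree_graph_def)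
  have "Min (a ` V) \<in> a ` V" "Max (a ` V) \<in> a ` V"
    using finite_V assms by (auto intro!: Min_in Max_in simp del: Min_in Max_in)
  then obtain p q where "p \<in> V" "a p = Min (a ` V)" "q \<in> V" "a q = Max (a ` V)" by force
  then have pq: "p \<in> V" "q \<in> V" "\<And>v. v \<in> V \<Longrightarrow> a p \<le> a v" "\<And>v. v \<in> V \<Longrightarrow> a v \<le> a q"
    using finite_V by simp_all
  obtain S where S: "S \<subseteq> V" "p \<in> S" "\<forall>w\<in>S. (w, r) \<in> (adj_on E S)\<^sup>*" "inj_on ?d S"
    using geodesic_set[OF con assms pq(1)] by blast
  obtain S' where S': "S' \<subseteq> V" "q \<in> S'" "\<forall>w\<in>S'. (w, r) \<in> (adj_on E S')\<^sup>*" "inj_on ?d S'"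
    using geodesic_set[OF con assms pq(2)] by blast
  \<comment> \<open>The two geodesics meet at the root, so their union is connected and contains
    both a leftmost and a rightmost bar.\<close>
  have "(w, r) \<in> (adj_on E (S \<union> S'))\<^sup>*" if "w \<in> S \<union> S'" for w
    using S(3) S'(3) that adj_on_mono[of S "S \<union> S'"] adj_on_mono[of S' "S \<union> S'"] by blast
  then have "(v, w) \<in> (adj_on E (S \<union> S'))\<^sup>*" if "v \<in> S \<union> S'" "w \<in> S \<union> S'" for v w
    using that by (meson adj_on_rtrancl_sym rtrancl_trans)
  then have spine: "v \<in> S \<union> S'" if "branching v" for v
    using branching_on_spine[OF that, of "S \<union> S'" p q] S S' pq by blast
  let ?L = "{v \<in> S. ?d v = i}" and ?R = "{v \<in> S'. ?d v = i}"
  have fin: "finite ?L" "finite ?R" using S S' finite_V by (auto intro: finite_subset)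
  have "card ?L \<le> 1" by (rule card_le_1I[OF fin(1)]) (use S(4) in \<open>auto dest: inj_onD\<close>)
  moreover have "card ?R \<le> 1" by (rule card_le_1I[OF fin(2)]) (use S'(4) in \<open>auto dest: inj_onD\<close>)
  moreover have "card {v \<in> V. branching v \<and> ?d v = i} \<le> card (?L \<union> ?R)"
    using spine fin by (intro card_mono) auto
  ultimately show ?thesis using card_Un_le[of ?L ?R] by linarith
qed

lemma card_level:
  assumes r: "r \<in> V"
  shows "card {v \<in> V. graph_dist V E r v = i} \<le> 2 * i + 1"
proof (induction i)
  let ?d = "graph_dist V E r"
  let ?L = "\<lambda>i. {v \<in> V. ?d v = i}"
  have con: "connected_graph V E" using tree by (simp add: tree_graph_def)
  have fin: "finite (?L i)" for i using finite_V by simp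
  have parent: "\<exists>u\<in>?L i. v \<in> nbrs u" if "v \<in> ?L (Suc i)" for v i
  proof -
    have "v \<noteq> r" using that graph_dist_self[OF r, of E] by auto
    with graph_dist_parent[OF con r, of v] that show ?thesis by (auto simp: nbrs_def)
  qed
  have L0: "?L 0 \<subseteq> {r}"
    using graph_dist_parent[OF con r] by fastforce
  {
    case 0
    from card_mono[OF _ L0] show ?case by simp
  next
    case (Suc i)
    show ?case
    proof (cases "i = 0")
      case True
      \<comment> \<open>The root has no parent, so all of its at most three neighbours may be
        children; this step is therefore separate.\<close>
      have "?L (Suc i) \<subseteq> nbrs r" using parent[of _ 0] L0 True by blast
      then have "card (?L (Suc i)) \<le> card (nbrs r)" by (rule card_mono[OF finite_nbrs])
      with card_nbrs_le_3[of r] True show ?thesis by simp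
    next
      case False
      \<comment> \<open>Below the root, one neighbour of \<open>u\<close> is its parent. This leaves
        at most one child, or two if \<open>u\<close> is branching.\<close>
      have children: "card (nbrs u \<inter> ?L (Suc i)) \<le> 1 + (if branching u then 1 else 0)"
        if u: "u \<in> ?L i" for u
      proof -
        obtain p where p: "p \<in> nbrs u" "?d p < i"
          using parent[of u "i - 1"] u False by (fastforce simp: nbrs_def insert_commute)
        then have "card (nbrs u \<inter> ?L (Suc i)) \<le> card (nbrs u - {p})"
          using finite_nbrs by (intro card_mono) auto
        also have "\<dots> = card (nbrs u) - 1" using p finite_nbrs by simp
        finally show ?thesis using card_nbrs_le_2[of u] card_nbrs_le_3[of u] by auto
      qed
      have "?L (Suc i) \<subseteq> (\<Union>u\<in>?L i. nbrs u \<inter> ?L (Suc i))" using parent[of _ i] by blast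
      then have "card (?L (Suc i)) \<le> card (\<Union>u\<in>?L i. nbrs u \<inter> ?L (Suc i))"
        using fin finite_nbrs by (intro card_mono) auto
      also have "\<dots> \<le> (\<Sum>u\<in>?L i. card (nbrs u \<inter> ?L (Suc i)))" by (rule card_UN_le[OF fin])
      also have "\<dots> \<le> (\<Sum>u\<in>?L i. 1 + (if branching u then 1 else 0))"
        by (rule sum_mono) (use children in blast)
      also have "\<dots> = card (?L i) + card {u \<in> ?L i. branching u}"
        using fin[of i] by (simp only: sum.distrib sum.inter_filter[symmetric] card_eq_sum)
      also have "{u \<in> ?L i. branching u} = {u \<in> V. branching u \<and> ?d u = i}" by auto
      also have "card (?L i) + card {u \<in> V. branching u \<and> ?d u = i} \<le> (2 * i + 1) + 2"
        by (intro add_mono Suc.IH card_branching_level r)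
      finally show ?thesis by simp
    qed
  }
qed

lemma card_V_le:
  assumes "r \<in> V"
  shows "card V \<le> (depth V E r + 1)\<^sup>2"
proof -
  let ?d = "graph_dist V E r" and ?s = "depth V E r"
  have "?d v \<le> ?s" if "v \<in> V" for v
    unfolding depth_def using that finite_V by simp
  then have "V = (\<Union>i\<in>{..?s}. {v \<in> V. ?d v = i})" by auto
  then have "card V \<le> (\<Sum>i\<le>?s. card {v \<in> V. ?d v = i})" by (metis card_UN_le finite_atMost)
  also have "\<dots> \<le> (\<Sum>i\<le>?s. 2 * i + 1)" by (intro sum_mono card_level assms)
  also have "(\<Sum>i\<le>n. 2 * i + 1) = (n + 1)\<^sup>2" for n :: nat
    by (induction n) (auto simp: power2_eq_square)
  finally show ?thesis .
qed

end

theorem theorem6p1: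
  fixes V :: "'a set" and E :: "'a set set" and r :: 'a and s :: nat
  assumes "rooted_tree V E r"
    and "depth V E r = s"
    and "unit_bar_visibility_graph V E"
  shows "card E \<le> s ^ 2 + 2 * s"
proof -
  from assms(3) obtain B where bars: "\<forall>v\<in>V. unit_bar (B v)" and dis: "disjoint_family_on B V"
    and vis: "\<And>u v. u \<in> V \<Longrightarrow> v \<in> V \<Longrightarrow> u \<noteq> v \<Longrightarrow> {u, v} \<in> E \<longleftrightarrow> bars_visible V B u v"
    unfolding unit_bar_visibility_graph_def by blast
  from bars obtain a h where B: "\<And>v. v \<in> V \<Longrightarrow> B v = {a v..a v + 1} \<times> {h v}"
    unfolding unit_bar_def by metis
  have "unit_bar_tree V E a h"
  proof
    show "tree_graph V E" using assms(1) by (simp add: rooted_tree_def)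
    show "disjoint_family_on (\<lambda>v. {a v..a v + 1} \<times> {h v}) V"
      using dis B unfolding disjoint_family_on_def by metis
    fix u v assume uv: "u \<in> V" "v \<in> V" "u \<noteq> v"
    \<comment> \<open>The coordinates describe \<open>B\<close> only on \<open>V\<close>, but
      visibility between vertices evaluates \<open>B\<close> nowhere else.\<close>
    have "bars_visible V B u v \<longleftrightarrow> bars_visible V (\<lambda>v. {a v..a v + 1} \<times> {h v}) u v"
      unfolding bars_visible_def using B uv by simp
    with vis[OF uv] show "{u, v} \<in> E \<longleftrightarrow> bars_visible V (\<lambda>v. {a v..a v + 1} \<times> {h v}) u v" by simp
  qed
  then have "card V \<le> (s + 1)\<^sup>2"
    using unit_bar_tree.card_V_le assms(1,2) unfolding rooted_tree_def by metis
  with card_edges_less_card_vertices[OF assms(1)] show ?thesis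
    by (simp add: power2_eq_square)
qed

end
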